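(* Let $X\subseteq\mathbb R^d$ be nonempty, closed and convex, let $f$ be differentiable on an open convex set $U\supseteq X$, and let $h:U\to\mathbb R$ be continuously differentiable and 1-strongly convex with respect to $\|\cdot\|_1$. Suppose that $f$ is $\rho$-relatively weakly convex with respect to $h$ for some $\rho>0$, i.e. $f+\rho h$ is convex, and that $\lambda\in(0,\rho^{-1})$. Then for every $\mathbf x\in X$, $$r(\mathbf x)\ge(1-\lambda\rho)\,r_2(\mathbf x),$$ where $$r(\mathbf x)=\inf\{\|\mathbf v\|_\infty:\mathbf v\in\partial(f+\delta_X)(\mathbf x)\},\qquad r_2(\mathbf x)=\frac1\lambda\sqrt{D_h(\mathbf x,\mathrm{prox}_{\lambda f}(\mathbf x))+D_h(\mathrm{prox}_{\lambda f}(\mathbf x),\mathbf x)}.$$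
   Context: $D_h(\mathbf u,\mathbf v)=h(\mathbf u)-h(\mathbf v)-\langle\nabla h(\mathbf v),\mathbf u-\mathbf v\rangle$ is the Bregman divergence of $h$; 1-strong convexity with respect to $\|\cdot\|_1$ means $D_h(\mathbf u,\mathbf v)\ge\frac12\|\mathbf u-\mathbf v\|_1^2$. The Bregman proximal operator is $\mathrm{prox}_{\lambda f}(\mathbf x)=\arg\min_{\mathbf z\in X}\{f(\mathbf z)+\frac1\lambda D_h(\mathbf z,\mathbf x)\}$ (well defined for $\lambda\in(0,\rho^{-1})$). $\delta_X$ is the indicator function of $X$ ($0$ on $X$, $+\infty$ off $X$) and $\partial$ is the Fréchet subdifferential, so $\partial(f+\delta_X)(\mathbf x)=\nabla f(\mathbf x)+N_X(\mathbf x)$ for $\mathbf x\in X$, with $N_X$ the normal cone. *)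

theory Defs
  imports "HOL-Analysis.Analysis"
begin

definition gradient :: "('a::real_inner \<Rightarrow> real) \<Rightarrow> 'a \<Rightarrow> 'a" where
  "gradient f x = (THE D. GDERIV f x :> D)"

definition l1_norm :: "real ^ 'd \<Rightarrow> real" where
  "l1_norm x = (\<Sum>i\<in>UNIV. \<bar>x $ i\<bar>)"

definition bregman :: "('a::real_inner \<Rightarrow> real) \<Rightarrow> 'a \<Rightarrow> 'a \<Rightarrow> real" where
  "bregman h u v = h u - h v - gradient h v \<bullet> (u - v)"

definition strongly_convex_l1 :: "(real ^ 'd) set \<Rightarrow> (real ^ 'd \<Rightarrow> real) \<Rightarrow> bool" where
  "strongly_convex_l1 U h \<longleftrightarrow>
     (\<forall>u\<in>U. \<forall>v\<in>U. bregman h u v \<ge> 1 / 2 * (l1_norm (u - v))\<^sup>2)"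

definition relatively_weakly_convex ::
    "'a::real_vector set \<Rightarrow> real \<Rightarrow> ('a \<Rightarrow> real) \<Rightarrow> ('a \<Rightarrow> real) \<Rightarrow> bool" where
  "relatively_weakly_convex U \<rho> f h \<longleftrightarrow> convex_on U (\<lambda>x. f x + \<rho> * h x)"

text \<open>\<^const>\<open>arg_min_on\<close> selects some minimiser over \<open>X\<close>; for the parameters considered
  here the objective is strongly convex on \<open>X\<close>, so the minimiser exists and is unique.\<close>

definition bregman_prox ::
    "'a::real_inner set \<Rightarrow> ('a \<Rightarrow> real) \<Rightarrow> real \<Rightarrow> ('a \<Rightarrow> real) \<Rightarrow> 'a \<Rightarrow> 'a" where
  "bregman_prox X h lam f x = arg_min_on (\<lambda>z. f z + 1 / lam * bregman h z x) X"

definition convex_indicator :: "'a set \<Rightarrow> 'a \<Rightarrow> ereal" where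
  "convex_indicator X x = (if x \<in> X then 0 else \<infinity>)"

text \<open>By convention the Frechet subdifferential is empty where the function is not finite.\<close>

definition frechet_subdifferential :: "('a::real_inner \<Rightarrow> ereal) \<Rightarrow> 'a \<Rightarrow> 'a set" where
  "frechet_subdifferential F x =
     {v. \<bar>F x\<bar> \<noteq> \<infinity> \<and>
         Liminf (at x) (\<lambda>y. (F y - F x - ereal (v \<bullet> (y - x))) / ereal (norm (y - x))) \<ge> 0}"

text \<open>The library's \<^const>\<open>infnorm\<close> is the maximum norm on \<open>\<real>\<^sup>d\<close>.  The infimum below is over a
  nonempty set of nonnegative reals when \<open>f\<close> is differentiable at \<open>x \<in> X\<close>: the
  subdifferential then contains the gradient of \<open>f\<close>.\<close>

definition stationarity_residual ::
    "(real ^ 'd) set \<Rightarrow> (real ^ 'd \<Rightarrow> real) \<Rightarrow> real ^ 'd \<Rightarrow> real" where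
  "stationarity_residual X f x =
     Inf (infnorm ` frechet_subdifferential (\<lambda>y. ereal (f y) + convex_indicator X y) x)"

definition bregman_prox_residual ::
    "(real ^ 'd) set \<Rightarrow> (real ^ 'd \<Rightarrow> real) \<Rightarrow> real \<Rightarrow> (real ^ 'd \<Rightarrow> real) \<Rightarrow> real ^ 'd \<Rightarrow> real" where
  "bregman_prox_residual X h lam f x =
     1 / lam * sqrt (bregman h x (bregman_prox X h lam f x) + bregman h (bregman_prox X h lam f x) x)"

end

theory Submission
  imports Defs
begin

text \<open>Let \<open>p\<close> be the proximal point of \<open>x\<close> and
  \<open>S = \<langle>\<nabla>h x - \<nabla>h p, x - p\<rangle> = D\<^sub>h(x,p) + D\<^sub>h(p,x)\<close>.
  First-order optimality of \<open>p\<close> tested at \<open>x\<close>, monotonicity of \<open>\<nabla>(f + \<rho> h)\<close>, and the inequality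
  defining a subgradient \<open>v\<close> of \<open>f + \<delta>\<^sub>X\<close> at \<open>x\<close> tested at \<open>p\<close> add up to
  \<open>\<langle>v, x - p\<rangle> \<ge> (1/\<lambda> - \<rho>) S\<close>.  The left-hand side is at most
  \<open>\<parallel>v\<parallel>\<^sub>\<infinity> \<parallel>x - p\<parallel>\<^sub>1\<close>, and \<open>\<parallel>x - p\<parallel>\<^sub>1 \<le> \<surd>S\<close> by strong convexity; dividing by \<open>\<surd>S\<close> gives the claim.\<close>

section \<open>Gradients and one-sided difference quotients\<close>

text \<open>\<open>gradient\<close> is a definite description, so it has to be pinned down first:
  the Riesz representation of the derivative gives existence, uniqueness of derivatives the
  rest.\<close>

lemma has_derivative_gradient:
  fixes f :: "'a::euclidean_space \<Rightarrow> real"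
  assumes "f differentiable (at x)"
  shows "(f has_derivative (\<lambda>d. gradient f x \<bullet> d)) (at x)"
proof -
  obtain D where D: "(f has_derivative D) (at x)"
    using assms by (auto simp: differentiable_def)
  then interpret linear D by (rule has_derivative_linear)
  define G where "G = (\<Sum>b\<in>Basis. D b *\<^sub>R b)"
  have "D y = G \<bullet> y" for y
  proof -
    have "D y = D (\<Sum>b\<in>Basis. (y \<bullet> b) *\<^sub>R b)" by (simp add: euclidean_representation)
    also have "\<dots> = (\<Sum>b\<in>Basis. (y \<bullet> b) * D b)" by (simp add: sum scale)
    also have "\<dots> = G \<bullet> y"
      by (simp add: G_def inner_sum_left inner_commute[of y] mult.commute)
    finally show ?thesis .
  qed
  then have "D = (\<lambda>d. d \<bullet> G)" by (simp add: fun_eq_iff inner_commute)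
  with D have G: "GDERIV f x :> G" by (simp add: gderiv_def)
  moreover have "G' = G" if "GDERIV f x :> G'" for G'
  proof -
    have "(\<lambda>d. d \<bullet> G') = (\<lambda>d. d \<bullet> G)"
      using that G unfolding gderiv_def by (rule has_derivative_unique)
    then show ?thesis by (metis inner_commute vector_eq_rdot)
  qed
  ultimately have "gradient f x = G" unfolding gradient_def by (rule the_equality)
  with G show ?thesis by (simp add: gderiv_def inner_commute)
qed

text \<open>A lower bound on the difference quotients for small \<open>t > 0\<close> survives the
  limit. Since only points on one side are tested, this also serves at boundary points of
  \<open>X\<close>, in directions pointing into \<open>X\<close>.\<close>

lemma directional_derivative_ge:
  fixes f :: "'a::real_inner \<Rightarrow> real"
  assumes "(f has_derivative (\<lambda>d. G \<bullet> d)) (at x)"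
    and "\<forall>\<^sub>F t in at_right 0. f (x + t *\<^sub>R d) \<ge> f x + t * c"
  shows "G \<bullet> d \<ge> c"
proof -
  have "((\<lambda>t. x + t *\<^sub>R d) has_derivative (\<lambda>t. t *\<^sub>R d)) (at 0)"
    by (auto intro!: derivative_eq_intros)
  moreover have "(f has_derivative (\<lambda>d. G \<bullet> d)) (at (x + 0 *\<^sub>R d))"
    using assms(1) by simp
  ultimately have "((\<lambda>t. f (x + t *\<^sub>R d)) has_derivative (\<lambda>t. G \<bullet> (t *\<^sub>R d))) (at 0)"
    by (rule has_derivative_compose)
  then have "((\<lambda>t. f (x + t *\<^sub>R d)) has_field_derivative (G \<bullet> d)) (at 0)"
    by (simp add: has_field_derivative_def mult.commute mult_commute_abs)
  then have "((\<lambda>t. (f (x + t *\<^sub>R d) - f x) / t) \<longlongrightarrow> G \<bullet> d) (at 0)"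
    by (simp add: has_field_derivative_iff)
  then have "((\<lambda>t. (f (x + t *\<^sub>R d) - f x) / t) \<longlongrightarrow> G \<bullet> d) (at_right 0)"
    by (rule tendsto_mono[rotated]) (simp add: at_le)
  moreover have "\<forall>\<^sub>F t in at_right 0. c \<le> (f (x + t *\<^sub>R d) - f x) / t"
    using assms(2) eventually_at_right_less[of "0::real"]
    by eventually_elim (simp add: field_simps)
  ultimately show ?thesis
    by (rule tendsto_lowerbound) simp
qed

lemma eventually_convex_segment:
  fixes x y :: "'a::real_normed_vector"
  assumes "convex X" "x \<in> X" "y \<in> X"
  shows "\<forall>\<^sub>F t in at_right (0::real). 0 < t \<and> t < 1 \<and> x + t *\<^sub>R (y - x) \<in> X"
proof -
  have "\<forall>\<^sub>F t in at_right (0::real). t \<in> {0<..<1}"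
    by (rule eventually_at_right_real) simp
  then show ?thesis
  proof eventually_elim
    case (elim t)
    have "(1 - t) *\<^sub>R x + t *\<^sub>R y \<in> X"
      using assms elim by (intro convexD) auto
    with elim show ?case by (simp add: algebra_simps)
  qed
qed

lemma convex_on_gradient_inequality:
  fixes f :: "'a::real_inner \<Rightarrow> real"
  assumes "convex_on U f" "x \<in> U" "y \<in> U"
    and "(f has_derivative (\<lambda>d. G \<bullet> d)) (at x)"
  shows "f y \<ge> f x + G \<bullet> (y - x)"
proof -
  have U: "convex U" using assms(1) by (rule convex_on_imp_convex)
  \<comment> \<open>Convexity bounds the quotients of \<open>f\<close> from above, hence the passage
    to \<open>- f\<close>.\<close>
  have "(- G) \<bullet> (y - x) \<ge> - (f y - f x)"
  proof (rule directional_derivative_ge)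
    show "((\<lambda>z. - f z) has_derivative (\<lambda>d. (- G) \<bullet> d)) (at x)"
      using has_derivative_minus[OF assms(4)] by simp
    show "\<forall>\<^sub>F t in at_right 0. - f (x + t *\<^sub>R (y - x)) \<ge> - f x + t * - (f y - f x)"
      using eventually_convex_segment[OF U assms(2,3)]
    proof eventually_elim
      case (elim t)
      have "f ((1 - t) *\<^sub>R x + t *\<^sub>R y) \<le> (1 - t) * f x + t * f y"
        using elim assms by (intro convex_onD) auto
      then show ?case by (simp add: algebra_simps)
    qed
  qed
  then show ?thesis by simp
qed

section \<open>Subgradients of \<open>f + \<delta>\<^sub>X\<close>\<close>

text \<open>On the segment from \<open>x\<close> to \<open>y\<close> the indicator vanishes, so the
  subgradient condition there concerns \<open>f\<close> alone and compares \<open>v\<close> with its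
  directional derivative. In other words, \<open>v - gradient f x\<close> lies in the normal cone of
  \<open>X\<close> at \<open>x\<close>.\<close>

lemma frechet_subdifferential_constrained_le:
  fixes f :: "'a::euclidean_space \<Rightarrow> real"
  assumes "convex X" "x \<in> X" "y \<in> X" "f differentiable (at x)"
    and v: "v \<in> frechet_subdifferential (\<lambda>y. ereal (f y) + convex_indicator X y) x"
  shows "v \<bullet> (y - x) \<le> gradient f x \<bullet> (y - x)"
proof (cases "y = x")
  case False
  define d where "d = y - x"
  have d: "norm d > 0" using False by (simp add: d_def)
  have "v \<bullet> d - e \<le> gradient f x \<bullet> d" if "e > 0" for e
  proof (rule directional_derivative_ge[OF has_derivative_gradient[OF assms(4)]])
    \<comment> \<open>At \<open>x + t *\<^sub>R d\<close> the denominator is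
      \<open>t * norm d\<close>, so this threshold costs exactly \<open>t * e\<close>.\<close>
    have e: "- ereal (e / norm d) < 0" using that d by simp
    define Q where "Q = (\<lambda>y. (ereal (f y) + convex_indicator X y - (ereal (f x) + convex_indicator X x)
            - ereal (v \<bullet> (y - x))) / ereal (norm (y - x)))"
    have "0 \<le> Liminf (at x) Q"
      using v by (simp add: frechet_subdifferential_def Q_def)
    then have "\<forall>\<^sub>F y in at x. - ereal (e / norm d) < Q y"
      using e by (auto simp: le_Liminf_iff)
    moreover have "filterlim (\<lambda>t. x + t *\<^sub>R d) (at x) (at_right 0)"
    proof (rule filterlim_atI)
      show "((\<lambda>t. x + t *\<^sub>R d) \<longlongrightarrow> x) (at_right 0)"
        by (auto intro!: tendsto_eq_intros)
      show "\<forall>\<^sub>F t in at_right 0. x + t *\<^sub>R d \<noteq> x"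
        using eventually_at_right_less[of "0::real"] by eventually_elim (use d in auto)
    qed
    ultimately have "\<forall>\<^sub>F t in at_right 0. - ereal (e / norm d) < Q (x + t *\<^sub>R d)"
      by (rule eventually_compose_filterlim)
    with eventually_convex_segment[OF assms(1-3)]
    show "\<forall>\<^sub>F t in at_right 0. f (x + t *\<^sub>R d) \<ge> f x + t * (v \<bullet> d - e)"
    proof eventually_elim
      case (elim t)
      then have "x + t *\<^sub>R d \<in> X" "t > 0" by (auto simp: d_def)
      with elim assms(2) d have
        "- (e / norm d) < (f (x + t *\<^sub>R d) - f x - t * (v \<bullet> d)) / (t * norm d)"
        by (simp add: Q_def convex_indicator_def flip: zero_ereal_def)
      then have "- e * t < f (x + t *\<^sub>R d) - f x - t * (v \<bullet> d)"
        using d \<open>t > 0\<close> by (simp add: field_simps)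
      then show ?case by (simp add: algebra_simps)
    qed
  qed
  then have "v \<bullet> d \<le> gradient f x \<bullet> d + e" if "e > 0" for e
    using that by (simp add: algebra_simps)
  then show ?thesis unfolding d_def by (rule field_le_epsilon)
qed simp

text \<open>Adding the indicator can only raise the quotients of \<open>f\<close>, which tend to 0.
  The lemma makes the set under the infimum in \<open>stationarity_residual\<close>
  nonempty.\<close>

lemma gradient_in_frechet_subdifferential_constrained:
  fixes f :: "'a::euclidean_space \<Rightarrow> real"
  assumes "x \<in> X" "f differentiable (at x)"
  shows "gradient f x \<in> frechet_subdifferential (\<lambda>y. ereal (f y) + convex_indicator X y) x"
proof -
  define q where "q = (\<lambda>y. (f y - f x - gradient f x \<bullet> (y - x)) / norm (y - x))"
  define Q where "Q = (\<lambda>y. (ereal (f y) + convex_indicator X y - (ereal (f x) + convex_indicator X x)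
            - ereal (gradient f x \<bullet> (y - x))) / ereal (norm (y - x)))"
  have "(q \<longlongrightarrow> 0) (at x)"
    using has_derivative_gradient[OF assms(2)]
    unfolding has_derivative_at_within q_def by (auto simp: divide_inverse mult.commute diff_diff_eq)
  then have "((\<lambda>y. ereal (q y)) \<longlongrightarrow> ereal 0) (at x)" by simp
  then have "Liminf (at x) (\<lambda>y. ereal (q y)) = 0"
    by (simp add: lim_imp_Liminf zero_ereal_def)
  moreover have "Liminf (at x) (\<lambda>y. ereal (q y)) \<le> Liminf (at x) Q"
  proof (rule Liminf_mono)
    have "\<forall>\<^sub>F y in at x. y \<noteq> x" by (simp add: eventually_at_filter)
    \<comment> \<open>The two quotients agree on \<open>X\<close>; off \<open>X\<close> the right
      one is infinite.\<close>
    then show "\<forall>\<^sub>F y in at x. ereal (q y) \<le> Q y"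
      by eventually_elim (use assms(1) in \<open>auto simp: q_def Q_def convex_indicator_def\<close>)
  qed
  ultimately show ?thesis
    using assms(1) by (simp add: frechet_subdifferential_def Q_def convex_indicator_def)
qed

section \<open>Duality of the norms and Bregman divergences\<close>

lemma inner_le_infnorm_l1_norm: "v \<bullet> w \<le> infnorm v * l1_norm w"
proof -
  have "v \<bullet> w = (\<Sum>i\<in>UNIV. v $ i * w $ i)" by (simp add: inner_vec_def)
  also have "\<dots> \<le> (\<Sum>i\<in>UNIV. infnorm v * \<bar>w $ i\<bar>)"
  proof (rule sum_mono)
    fix i
    have "v $ i * w $ i \<le> \<bar>v $ i\<bar> * \<bar>w $ i\<bar>" by (metis abs_ge_self abs_mult)
    also have "\<dots> \<le> infnorm v * \<bar>w $ i\<bar>"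
      by (intro mult_right_mono component_le_infnorm_cart) simp
    finally show "v $ i * w $ i \<le> infnorm v * \<bar>w $ i\<bar>" .
  qed
  also have "\<dots> = infnorm v * l1_norm w" by (simp add: l1_norm_def sum_distrib_left)
  finally show ?thesis .
qed

lemma bregman_add_commute:
  "bregman h x y + bregman h y x = (gradient h x - gradient h y) \<bullet> (x - y)"
  by (simp add: bregman_def algebra_simps)

lemma strongly_convex_l1_gradient_monotone:
  assumes "strongly_convex_l1 U h" "u \<in> U" "v \<in> U"
  shows "(l1_norm (u - v))\<^sup>2 \<le> bregman h u v + bregman h v u"
proof -
  have "l1_norm (v - u) = l1_norm (u - v)" by (simp add: l1_norm_def abs_minus_commute)
  then show ?thesis
    using assms unfolding strongly_convex_l1_def by (metis add_mono field_sum_of_halves mult.commute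
        times_divide_eq_right mult.right_neutral)
qed

text \<open>This is the gradient inequality of the convex function \<open>f + \<rho> h\<close>, with
  the terms in \<open>h\<close> gathered into a divergence.\<close>

lemma relatively_weakly_convex_ge:
  fixes f h :: "'a::euclidean_space \<Rightarrow> real"
  assumes "relatively_weakly_convex U \<rho> f h" "u \<in> U" "v \<in> U"
    and "f differentiable (at v)" "h differentiable (at v)"
  shows "f u \<ge> f v + gradient f v \<bullet> (u - v) - \<rho> * bregman h u v"
proof -
  have "((\<lambda>x. f x + \<rho> * h x) has_derivative (\<lambda>d. (gradient f v + \<rho> *\<^sub>R gradient h v) \<bullet> d)) (at v)"
    using has_derivative_gradient[OF assms(4)] has_derivative_gradient[OF assms(5)]
    by (auto intro!: derivative_eq_intros simp: algebra_simps)
  from convex_on_gradient_inequality[OF _ assms(3,2) this] assms(1) show ?thesis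
    by (simp add: relatively_weakly_convex_def bregman_def algebra_simps)
qed

section \<open>Existence and first-order optimality of the proximal point\<close>

text \<open>Outside a ball around \<open>x\<close> the objective exceeds its value at
  \<open>x\<close>, so a minimiser over the compact part of \<open>X\<close> in the ball is global.
  The choice behind \<open>arg_min_on\<close> then yields a minimiser too.\<close>

lemma bregman_prox_is_minimizer:
  fixes X U :: "(real ^ 'd) set" and f h :: "real ^ 'd \<Rightarrow> real"
  assumes "closed X" "X \<subseteq> U" "open U"
    and f: "f differentiable_on U" and h: "h differentiable_on U"
    and "strongly_convex_l1 U h" "relatively_weakly_convex U \<rho> f h"
    and "0 < lam" "lam * \<rho> < 1" and x: "x \<in> X"
  defines "\<phi> \<equiv> \<lambda>z. f z + 1 / lam * bregman h z x"
  shows "bregman_prox X h lam f x \<in> X \<and> (\<forall>z\<in>X. \<phi> (bregman_prox X h lam f x) \<le> \<phi> z)"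
proof -
  define c where "c = 1 / lam - \<rho>"
  have c: "c > 0" using assms(8,9) by (simp add: c_def field_simps)
  define g where "g = gradient f x"
  \<comment> \<open>At distance \<open>n = R\<close> the quadratic growth
    \<open>c * n\<^sup>2 / 2\<close> balances the worst linear decrease \<open>norm g * n\<close>;
    beyond it the growth wins.\<close>
  define R where "R = 2 * norm g / c"
  have \<phi>x: "\<phi> x = f x" by (simp add: \<phi>_def bregman_def)
  have xU: "x \<in> U" using x assms(2) by auto
  have diff: "f differentiable (at z)" "h differentiable (at z)" if "z \<in> U" for z
    using that f h assms(3) by (auto simp: differentiable_on_def at_within_open[of z U])
  have far: "\<phi> x < \<phi> z" if z: "z \<in> X" "z \<notin> cball x R" for z
  proof -
    define n where "n = norm (z - x)"
    have zU: "z \<in> U" using z assms(2) by auto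
    have n: "R < n" using z by (simp add: n_def dist_norm norm_minus_commute)
    have "0 \<le> R" using c by (simp add: R_def)
    with n have n0: "n > 0" by simp
    have "n \<le> l1_norm (z - x)" unfolding n_def l1_norm_def by (rule norm_le_l1_cart)
    then have "1/2 * n\<^sup>2 \<le> 1/2 * (l1_norm (z - x))\<^sup>2" using n0 by (simp add: power_mono)
    also have "\<dots> \<le> bregman h z x"
      using assms(6) zU xU by (simp add: strongly_convex_l1_def)
    finally have "c * (1/2 * n\<^sup>2) \<le> c * bregman h z x" using c by simp
    \<comment> \<open>Of the weight \<open>1 / lam\<close> on the divergence, relative weak
      convexity consumes \<open>\<rho>\<close> and leaves \<open>c\<close>.\<close>
    moreover have "\<phi> z \<ge> f x + g \<bullet> (z - x) + c * bregman h z x"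
      using relatively_weakly_convex_ge[OF assms(7) zU xU diff[OF xU]]
      by (simp add: \<phi>_def g_def c_def algebra_simps)
    moreover have "g \<bullet> (z - x) \<ge> - (norm g * n)"
      using Cauchy_Schwarz_ineq2[of g "z - x"] by (simp add: n_def)
    moreover have "norm g * n < c * (1/2 * n\<^sup>2)"
      using n n0 c by (simp add: R_def field_simps power2_eq_square)
    ultimately show ?thesis using \<phi>x by linarith
  qed
  have "continuous_on U f" "continuous_on U h"
    using f h by (auto intro: differentiable_imp_continuous_on)
  then have "continuous_on (X \<inter> cball x R) f" "continuous_on (X \<inter> cball x R) h"
    using assms(2) by (auto intro: continuous_on_subset)
  then have "continuous_on (X \<inter> cball x R) \<phi>"
    unfolding \<phi>_def bregman_def by (intro continuous_intros)
  moreover have "compact (X \<inter> cball x R)" using assms(1) by (simp add: closed_Int_compact)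
  moreover have xR: "x \<in> X \<inter> cball x R" using x c by (simp add: R_def)
  ultimately obtain p where p: "p \<in> X \<inter> cball x R" "\<forall>z\<in>X \<inter> cball x R. \<phi> p \<le> \<phi> z"
    using continuous_attains_inf[of "X \<inter> cball x R" \<phi>] by blast
  have "\<phi> p \<le> \<phi> z" if "z \<in> X" for z
  proof (cases "z \<in> cball x R")
    case False
    have "\<phi> p \<le> \<phi> x" using p(2) xR by blast
    then show ?thesis using far[OF that False] by simp
  qed (use p(2) that in blast)
  then have "is_arg_min \<phi> (\<lambda>z. z \<in> X) p"
    using p by (auto simp: is_arg_min_def not_less)
  then have "is_arg_min \<phi> (\<lambda>z. z \<in> X) (bregman_prox X h lam f x)"
    unfolding bregman_prox_def arg_min_on_def arg_min_def \<phi>_def by (rule someI)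
  then show ?thesis by (auto simp: is_arg_min_def not_less)
qed

text \<open>Moving from \<open>p\<close> towards a point of \<open>X\<close> stays in
  \<open>X\<close> and cannot decrease \<open>f\<close>, so the difference quotients are
  nonnegative.\<close>

lemma minimizer_first_order:
  fixes f :: "'a::real_inner \<Rightarrow> real"
  assumes "convex X" "p \<in> X" "y \<in> X" "\<forall>z\<in>X. f p \<le> f z"
    and "(f has_derivative (\<lambda>d. G \<bullet> d)) (at p)"
  shows "G \<bullet> (y - p) \<ge> 0"
proof (rule directional_derivative_ge[OF assms(5)])
  show "\<forall>\<^sub>F t in at_right 0. f (p + t *\<^sub>R (y - p)) \<ge> f p + t * 0"
    using eventually_convex_segment[OF assms(1-3)]
    by eventually_elim (use assms(4) in auto)
qed

theorem lemma1:
  fixes X U :: "(real ^ 'd) set"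
    and f h :: "real ^ 'd \<Rightarrow> real"
    and \<rho> lam :: real
  assumes "X \<noteq> {}" and "closed X" and "convex X"
    and "open U" and "convex U" and "X \<subseteq> U"
    and "f differentiable_on U"
    and "h differentiable_on U" and "continuous_on U (gradient h)"
    and "strongly_convex_l1 U h"
    and "\<rho> > 0" and "relatively_weakly_convex U \<rho> f h"
    and "lam \<in> {0<..<inverse \<rho>}"
  shows "\<forall>x\<in>X. stationarity_residual X f x \<ge> (1 - lam * \<rho>) * bregman_prox_residual X h lam f x"
proof
  fix x assume x: "x \<in> X"
  have lam: "0 < lam" "lam * \<rho> < 1"
    using assms(11,13) by (auto simp: field_simps)
  \<comment> \<open>The factor \<open>1 - lam * \<rho>\<close> times the prefactor
    \<open>1 / lam\<close> of the proximal residual is \<open>c\<close>, so the goal becomes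
    \<open>c * sqrt S\<close> as a lower bound.\<close>
  define c where "c = 1 / lam - \<rho>"
  have c: "c > 0" using lam by (simp add: c_def field_simps)
  define p where "p = bregman_prox X h lam f x"
  define S where "S = bregman h x p + bregman h p x"
  have p: "p \<in> X" and min: "\<forall>z\<in>X. f p + 1 / lam * bregman h p x \<le> f z + 1 / lam * bregman h z x"
    using bregman_prox_is_minimizer[OF assms(2,6,4,7,8,10,12) lam x] by (auto simp: p_def)
  have U: "x \<in> U" "p \<in> U" using x p assms(6) by auto
  have diff: "f differentiable (at z)" "h differentiable (at z)" if "z \<in> U" for z
    using that assms(4,7,8) by (auto simp: differentiable_on_def at_within_open[of z U])
  have "((\<lambda>z. f z + 1 / lam * bregman h z x) has_derivative
      (\<lambda>d. (gradient f p + (1 / lam) *\<^sub>R (gradient h p - gradient h x)) \<bullet> d)) (at p)"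
    unfolding bregman_def
    using diff[OF U(2), THEN has_derivative_gradient] lam(1)
    by (auto intro!: derivative_eq_intros simp: algebra_simps diff_divide_distrib)
  from minimizer_first_order[OF assms(3) p x min this]
  have opt: "gradient f p \<bullet> (x - p) \<ge> 1 / lam * S"
    by (simp add: S_def bregman_add_commute algebra_simps diff_divide_distrib)
  \<comment> \<open>In the sum of the two inequalities, with \<open>x\<close> and \<open>p\<close>
    exchanged, the values of \<open>f\<close> cancel.\<close>
  have mono: "(gradient f x - gradient f p) \<bullet> (x - p) \<ge> - \<rho> * S"
    using relatively_weakly_convex_ge[OF assms(12) U diff[OF U(2)]]
      relatively_weakly_convex_ge[OF assms(12) U(2,1) diff[OF U(1)]]
    by (simp add: S_def algebra_simps)
  have S: "(l1_norm (x - p))\<^sup>2 \<le> S"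
    unfolding S_def using strongly_convex_l1_gradient_monotone[OF assms(10) U] .
  then have l1: "l1_norm (x - p) \<le> sqrt S" by (rule real_le_rsqrt)
  have bound: "c * sqrt S \<le> infnorm v"
    if v: "v \<in> frechet_subdifferential (\<lambda>y. ereal (f y) + convex_indicator X y) x" for v
  \<comment> \<open>One factor \<open>sqrt S\<close> will be cancelled, which needs
    \<open>S > 0\<close>; for \<open>S = 0\<close> the left-hand side vanishes.\<close>
  proof (cases "S > 0")
    case True
    have "v \<bullet> (p - x) \<le> gradient f x \<bullet> (p - x)"
      by (rule frechet_subdifferential_constrained_le[OF assms(3) x p diff(1)[OF U(1)] v])
    \<comment> \<open>Reversing the sign of the direction gives the chain from \<open>v\<close> to
      \<open>gradient f x\<close> to \<open>gradient f p\<close>, losing \<open>\<rho> * S\<close>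
      and gaining \<open>1 / lam * S\<close>.\<close>
    then have "c * S \<le> v \<bullet> (x - p)"
      using opt mono by (simp add: c_def algebra_simps)
    also have "\<dots> \<le> infnorm v * l1_norm (x - p)" by (rule inner_le_infnorm_l1_norm)
    also have "\<dots> \<le> infnorm v * sqrt S" using l1 by (simp add: mult_left_mono infnorm_pos_le)
    finally have "(c * sqrt S) * sqrt S \<le> infnorm v * sqrt S"
      using True by (simp only: mult.assoc real_sqrt_mult_self abs_of_pos)
    moreover have "0 < sqrt S" using True by simp
    ultimately show ?thesis by (rule mult_right_le_imp_le)
  next
    case False
    moreover have "0 \<le> S" using S by (rule order_trans[rotated]) simp
    ultimately show ?thesis by (simp add: infnorm_pos_le)
  qed
  have "c * sqrt S \<le> stationarity_residual X f x"
    unfolding stationarity_residual_def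
  proof (rule cInf_greatest)
    show "infnorm ` frechet_subdifferential (\<lambda>y. ereal (f y) + convex_indicator X y) x \<noteq> {}"
      using gradient_in_frechet_subdifferential_constrained[OF x diff(1)[OF U(1)]] by blast
  qed (use bound in auto)
  moreover have "(1 - lam * \<rho>) * bregman_prox_residual X h lam f x = c * sqrt S"
    using lam by (simp add: bregman_prox_residual_def p_def S_def c_def field_simps)
  ultimately show "stationarity_residual X f x \<ge> (1 - lam * \<rho>) * bregman_prox_residual X h lam f x"
    by simp
qed

end
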